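(* Assume that the second-stage problem has complete recourse and dual strict feasibility (as defined in the context) and that $\Xi\subseteq\mathbb R^k$ is nonempty, closed and convex. Let $x\in\mathbb R^{n_x}$, let $\zeta^1,\dots,\zeta^N\in\Xi$, and let $\lambda\ge 0$. For each $i\in\{1,\dots,N\}$ consider the problem $$(P_i)\qquad \sup_{\xi\in\Xi}\; Z(x,\xi)-\lambda\|\xi-\zeta^i\| .$$ Then, for each $i\in\{1,\dots,N\}$, if $(P_i)$ has a finite optimum, it has an optimal solution that is either a boundary point of $\Xi$ or the point $\zeta^i$. Otherwise, $(P_i)$ is unbounded, meaning that $\lambda$ does not satisfy the condition $\sup_{\xi\in\Xi} Z(x,\xi)-\lambda\|\xi-\zeta^i\|<\infty$ for all $i\in\{1,\dots,N\}$.
   Context: $\|\cdot\|$ is the $l_p$-norm on $\mathbb R^k$ for some $p\in[1,\infty]$. $\mathcal K_y\subseteq\mathbb R^{n_y}$ is a Cartesian product of proper cones, with dual cone $\mathcal K_y^*$. $h:\mathbb R^{n_x}\to\mathbb R^{m_y}$ and $T:\mathbb R^{n_x}\to\mathbb R^{m_y\times k}$ are affine mappings; $q\in\mathbb R^{n_y}$ and $W\in\mathbb R^{m_y\times n_y}$. The second-stage cost is $$Z(x,\xi)=\inf_{y\in\mathcal K_y}\{q^Ty: Wy\ge h(x)+T(x)\xi\},$$ with dual $\sup_{\pi\in\Pi}(h(x)+T(x)\xi)^T\pi$, where $\Pi=\{\pi\ge 0: q-W^T\pi\in\mathcal K_y^*\}$. Complete recourse: for every right-hand side vector of the affine constraints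 in the second-stage problem (i.e. every vector in place of $h(x)+T(x)\xi$), the second-stage problem is feasible. Dual strict feasibility: the dual problem is feasible and has an interior point (strictly feasible point).
   Formalization: The supremum of (P_i) can be finite but not attained, so the optimal solution at a boundary point or at ζ^i is claimed only when some optimal solution exists; for any finite supremum, the supremum over the boundary of Ξ and ζ^i equals the optimal value. *)

theory Defs
  imports "HOL-Analysis.Analysis" "HOL-Library.Disjoint_Sets"
begin

definition lp_norm :: "ereal \<Rightarrow> real ^ 'n \<Rightarrow> real" where
  "lp_norm p v =
    (if p = \<infinity> then infnorm v
     else (\<Sum>i\<in>UNIV. \<bar>v $ i\<bar> powr real_of_ereal p) powr (1 / real_of_ereal p))"

definition affine_map :: "('a::real_vector \<Rightarrow> 'b::real_vector) \<Rightarrow> bool" where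
  "affine_map f \<longleftrightarrow> (\<exists>A b. linear A \<and> f = (\<lambda>x. A x + b))"

(* A factor R^d of R^n is represented by the coordinate subspace of a set J of d indices. *)
definition coord_subspace :: "'n set \<Rightarrow> (real ^ 'n) set" where
  "coord_subspace J = {v. \<forall>i. i \<notin> J \<longrightarrow> v $ i = 0}"

definition coord_proj :: "'n set \<Rightarrow> real ^ 'n \<Rightarrow> real ^ 'n" where
  "coord_proj J v = (\<chi> i. if i \<in> J then v $ i else 0)"

(* The interior is taken relative to the subspace S in which the cone lives. *)
definition proper_cone_in :: "'a::euclidean_space set \<Rightarrow> 'a set \<Rightarrow> bool" where
  "proper_cone_in S C \<longleftrightarrow>
     C \<subseteq> S \<and> cone C \<and> convex C \<and> closed C \<and>
     (\<forall>v. v \<in> C \<and> - v \<in> C \<longrightarrow> v = 0) \<and>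
     (top_of_set S) interior_of C \<noteq> {}"

definition product_of_proper_cones :: "(real ^ 'n) set \<Rightarrow> bool" where
  "product_of_proper_cones K \<longleftrightarrow>
     (\<exists>P C. partition_on UNIV P \<and>
            (\<forall>J\<in>P. proper_cone_in (coord_subspace J) (C J)) \<and>
            K = {y. \<forall>J\<in>P. coord_proj J y \<in> C J})"

definition dual_cone :: "'a::real_inner set \<Rightarrow> 'a set" where
  "dual_cone K = {z. \<forall>y\<in>K. 0 \<le> z \<bullet> y}"

definition second_stage_feasible ::
  "(real ^ 'ny) set \<Rightarrow> real ^ 'ny ^ 'my \<Rightarrow> real ^ 'my \<Rightarrow> (real ^ 'ny) set" where
  "second_stage_feasible K W r = {y \<in> K. \<forall>i. (W *v y) $ i \<ge> r $ i}"

definition second_stage_cost ::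
  "(real ^ 'ny) set \<Rightarrow> real ^ 'ny \<Rightarrow> real ^ 'ny ^ 'my \<Rightarrow>
   (real ^ 'nx \<Rightarrow> real ^ 'my) \<Rightarrow> (real ^ 'nx \<Rightarrow> real ^ 'k ^ 'my) \<Rightarrow>
   real ^ 'nx \<Rightarrow> real ^ 'k \<Rightarrow> ereal" where
  "second_stage_cost K q W h T x \<xi> =
     (INF y \<in> second_stage_feasible K W (h x + T x *v \<xi>). ereal (q \<bullet> y))"

definition dual_feasible ::
  "(real ^ 'ny) set \<Rightarrow> real ^ 'ny \<Rightarrow> real ^ 'ny ^ 'my \<Rightarrow> (real ^ 'my) set" where
  "dual_feasible K q W =
     {\<pi>. (\<forall>i. 0 \<le> \<pi> $ i) \<and> q - transpose W *v \<pi> \<in> dual_cone K}"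

definition complete_recourse :: "(real ^ 'ny) set \<Rightarrow> real ^ 'ny ^ 'my \<Rightarrow> bool" where
  "complete_recourse K W \<longleftrightarrow> (\<forall>r. second_stage_feasible K W r \<noteq> {})"

(* Strict feasibility in the conic (Slater) sense: every conic constraint of the dual
   holds in the interior of its cone.  The order < on vectors is not strict in every
   component, hence the explicit quantifier. *)
definition dual_strictly_feasible ::
  "(real ^ 'ny) set \<Rightarrow> real ^ 'ny \<Rightarrow> real ^ 'ny ^ 'my \<Rightarrow> bool" where
  "dual_strictly_feasible K q W \<longleftrightarrow>
     (\<exists>\<pi> \<in> dual_feasible K q W.
        (\<forall>i. 0 < \<pi> $ i) \<and> q - transpose W *v \<pi> \<in> interior (dual_cone K))"

definition penalized_cost ::
  "(real ^ 'ny) set \<Rightarrow> real ^ 'ny \<Rightarrow> real ^ 'ny ^ 'my \<Rightarrow>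
   (real ^ 'nx \<Rightarrow> real ^ 'my) \<Rightarrow> (real ^ 'nx \<Rightarrow> real ^ 'k ^ 'my) \<Rightarrow>
   ereal \<Rightarrow> real \<Rightarrow> real ^ 'nx \<Rightarrow> real ^ 'k \<Rightarrow> real ^ 'k \<Rightarrow> ereal" where
  "penalized_cost K q W h T p lam x z \<xi> =
     second_stage_cost K q W h T x \<xi> - ereal (lam * lp_norm p (\<xi> - z))"

end

theory Submission
  imports Defs
begin

text \<open>
  As a function of \<open>\<xi>\<close>, the second-stage cost is convex, because feasible second-stage decisions for
  two right-hand sides combine convexly. It is finite by complete recourse and weak duality.
  On every ray from \<open>\<zeta>\<close> the penalty is linear, so the penalized cost is convex on the ray.
  If the ray leaves \<open>\<Xi>\<close>, a point on it is dominated by \<open>\<zeta>\<close> or by a boundary point; if the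
  ray stays in \<open>\<Xi>\<close>, a convex function bounded above on it never exceeds its value at \<open>\<zeta>\<close>.
\<close>

text \<open>Convexity is required only along the ray from \<open>a\<close> towards \<open>b\<close>,
  because a convex cost minus a multiple of a norm need not be convex on the whole space.\<close>

lemma convex_on_ray_dominated:
  fixes g :: "'a::real_normed_vector \<Rightarrow> real"
  assumes S: "convex S" and a: "a \<in> S" and b: "b \<in> S"
    and cvx: "convex_on {0..} (\<lambda>t. g (a + t *\<^sub>R (b - a)))"
    and bdd: "\<And>x. x \<in> S \<Longrightarrow> g x \<le> M"
  shows "\<exists>c \<in> frontier S \<union> {a}. g b \<le> g c"
proof -
  define \<phi> where "\<phi> t = g (a + t *\<^sub>R (b - a))" for t
  have \<phi>0: "\<phi> 0 = g a" and \<phi>1: "\<phi> 1 = g b"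
    by (simp_all add: \<phi>_def)
  \<comment> \<open>The parameter 1 is the convex combination of 0 and \<open>t\<close> with weight
    \<open>1 / t\<close> on \<open>t\<close>.\<close>
  have chord: "\<phi> 1 \<le> (1 - 1 / t) * \<phi> 0 + (1 / t) * \<phi> t" if "1 \<le> t" for t
    using convex_onD[OF cvx, of "1 / t" 0 t] that by (simp add: \<phi>_def)
  show ?thesis
  proof (cases "\<forall>t\<ge>0. a + t *\<^sub>R (b - a) \<in> S")
    case True
    have "\<phi> 1 \<le> \<phi> 0"
    proof (rule ccontr)
      assume "\<not> \<phi> 1 \<le> \<phi> 0"
      then have pos: "\<phi> 1 - \<phi> 0 > 0" by simp
      \<comment> \<open>Extrapolating the slope \<open>\<phi> 1 - \<phi> 0\<close> from 0 to this
        parameter gives at least \<open>M + 1\<close>, which contradicts the bound. The maximum with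
        1 makes \<open>chord\<close> applicable.\<close>
      define t where "t = max 1 ((M - \<phi> 0 + 1) / (\<phi> 1 - \<phi> 0))"
      have t1: "1 \<le> t" by (simp add: t_def)
      have "(M - \<phi> 0 + 1) / (\<phi> 1 - \<phi> 0) \<le> t" by (simp add: t_def)
      then have "M - \<phi> 0 + 1 \<le> t * (\<phi> 1 - \<phi> 0)"
        using pos by (simp add: pos_divide_le_eq)
      moreover have "t * \<phi> 1 \<le> t * ((1 - 1 / t) * \<phi> 0 + (1 / t) * \<phi> t)"
        using t1 chord[OF t1] by (intro mult_left_mono) auto
      moreover have "t * ((1 - 1 / t) * \<phi> 0 + (1 / t) * \<phi> t) = (t - 1) * \<phi> 0 + \<phi> t"
        using t1 by (simp add: field_simps)
      ultimately have "M + 1 \<le> \<phi> t" by (simp add: algebra_simps)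
      moreover have "\<phi> t \<le> M"
        using True t1 by (auto simp: \<phi>_def intro!: bdd)
      ultimately show False by linarith
    qed
    then show ?thesis using \<phi>0 \<phi>1 by auto
  next
    case False
    then obtain t where t: "0 \<le> t" "a + t *\<^sub>R (b - a) \<notin> S" by blast
    have "1 < t"
    proof (rule ccontr)
      assume "\<not> 1 < t"
      then have "(1 - t) *\<^sub>R a + t *\<^sub>R b \<in> S"
        using S a b t(1) by (intro convexD_alt) auto
      then show False using t(2) by (simp add: algebra_simps)
    qed
    define e where "e = a + t *\<^sub>R (b - a)"
    \<comment> \<open>The segment is connected and runs from \<open>b\<close> in \<open>S\<close> to
      \<open>e\<close> outside \<open>S\<close>.\<close>
    have "closed_segment b e \<inter> frontier S \<noteq> {}"
      by (rule connected_Int_frontier) (use b t(2) in \<open>auto simp: e_def\<close>)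
    then obtain u where u: "0 \<le> u" "u \<le> 1" "(1 - u) *\<^sub>R b + u *\<^sub>R e \<in> frontier S"
      by (auto simp: closed_segment_def)
    \<comment> \<open>This is the ray parameter of the frontier point. As \<open>t > 1\<close>, it
      is at least 1, so that point lies at or beyond \<open>b\<close> as seen from
      \<open>a\<close>.\<close>
    define s where "s = 1 + u * (t - 1)"
    have s1: "1 \<le> s" using u \<open>1 < t\<close> by (simp add: s_def)
    have "(1 - u) *\<^sub>R b + u *\<^sub>R e = a + s *\<^sub>R (b - a)"
      by (simp add: s_def e_def algebra_simps)
    then have fr: "a + s *\<^sub>R (b - a) \<in> frontier S" using u(3) by simp
    have "(1 - 1 / s) * \<phi> 0 + (1 / s) * \<phi> s \<le> max (\<phi> 0) (\<phi> s)"
      using s1 by (intro convex_bound_le) auto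
    with chord[OF s1] have "\<phi> 1 \<le> max (\<phi> 0) (\<phi> s)" by linarith
    then show ?thesis
      using fr \<phi>0 \<phi>1 unfolding \<phi>_def max_def by (auto split: if_splits)
  qed
qed

text \<open>For finite \<open>p\<close>, the factor leaves the sum as \<open>c powr r\<close>, and
  the outer power \<open>1 / r\<close> turns it back into \<open>c\<close>. This makes the penalty
  linear on rays.\<close>

lemma lp_norm_scaleR:
  assumes p: "1 \<le> p" and c: "0 \<le> c"
  shows "lp_norm p (c *\<^sub>R v) = c * lp_norm p v"
proof (cases "p = \<infinity>")
  case True
  then show ?thesis using c by (simp add: lp_norm_def infnorm_mul)
next
  case False
  then obtain r where r: "p = ereal r" "1 \<le> r" using p by (cases p) auto
  have "(\<Sum>i\<in>UNIV. \<bar>(c *\<^sub>R v) $ i\<bar> powr r) = c powr r * (\<Sum>i\<in>UNIV. \<bar>v $ i\<bar> powr r)"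
    using c by (simp add: abs_mult powr_mult sum_distrib_left)
  then show ?thesis
    using r c by (simp add: lp_norm_def powr_mult sum_nonneg powr_powr)
qed

lemma linear_coord_proj: "linear (coord_proj J)"
  by (rule linearI) (auto simp: coord_proj_def vec_eq_iff)

lemma product_of_proper_cones_convex:
  assumes "product_of_proper_cones K"
  shows "convex K"
proof -
  obtain P C where PC: "\<forall>J\<in>P. proper_cone_in (coord_subspace J) (C J)"
      "K = {y. \<forall>J\<in>P. coord_proj J y \<in> C J}"
    using assms unfolding product_of_proper_cones_def by blast
  have "K = (\<Inter>J\<in>P. coord_proj J -` C J)" using PC(2) by auto
  then show ?thesis
    using PC(1)
    by (auto simp: proper_cone_in_def intro!: convex_INT convex_linear_vimage linear_coord_proj)
qed

text \<open>A single dual feasible point bounds all primal values from below, so the infimum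
  defining the cost cannot be minus infinity.\<close>

lemma second_stage_weak_duality:
  assumes "\<pi> \<in> dual_feasible K q W" and "y \<in> second_stage_feasible K W r"
  shows "\<pi> \<bullet> r \<le> q \<bullet> y"
proof -
  have "0 \<le> (q - transpose W *v \<pi>) \<bullet> y"
    using assms by (auto simp: dual_feasible_def dual_cone_def second_stage_feasible_def)
  moreover have "(transpose W *v \<pi>) \<bullet> y = \<pi> \<bullet> (W *v y)"
    by (simp add: dot_lmul_matrix)
  moreover have "\<pi> \<bullet> r \<le> \<pi> \<bullet> (W *v y)"
    unfolding inner_vec_def using assms
    by (intro sum_mono) (auto simp: dual_feasible_def second_stage_feasible_def mult_left_mono)
  ultimately show ?thesis by (simp add: inner_diff_left)
qed

text \<open>The pairs of a right-hand side and a feasible decision form a convex set. Minimizing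
  over the decision then preserves convexity.\<close>

lemma second_stage_feasible_convex_comb:
  assumes "convex K" and "y \<in> second_stage_feasible K W r" and "z \<in> second_stage_feasible K W s"
    and "0 \<le> u" "0 \<le> v" "u + v = 1"
  shows "u *\<^sub>R y + v *\<^sub>R z \<in> second_stage_feasible K W (u *\<^sub>R r + v *\<^sub>R s)"
  using assms
  by (auto simp: second_stage_feasible_def convex_def matrix_vector_right_distrib
      matrix_vector_mult_scaleR intro!: add_mono mult_left_mono)

text \<open>For fixed \<open>x\<close> the right-hand side is affine in \<xi>, so the cost is a
  partial minimum of a jointly convex problem. A real-valued \<open>Z\<close> is obtained so that
  \<open>convex_on\<close> applies.\<close>

lemma second_stage_cost_convex:
  fixes T :: "real ^ 'nx \<Rightarrow> real ^ 'k ^ 'my"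
  assumes K: "convex K" and rec: "complete_recourse K W" and dual: "dual_feasible K q W \<noteq> {}"
  obtains Z where "convex_on UNIV Z" and "\<And>\<xi>. second_stage_cost K q W h T x \<xi> = ereal (Z \<xi>)"
proof -
  define F where "F \<xi> = second_stage_feasible K W (h x + T x *v \<xi>)" for \<xi>
  define Z where "Z \<xi> = (INF y \<in> F \<xi>. q \<bullet> y)" for \<xi>
  obtain \<pi> where \<pi>: "\<pi> \<in> dual_feasible K q W" using dual by blast
  have ne: "F \<xi> \<noteq> {}" for \<xi>
    using rec by (simp add: F_def complete_recourse_def)
  have bdd: "bdd_below ((\<bullet>) q ` F \<xi>)" for \<xi>
    using second_stage_weak_duality[OF \<pi>] unfolding F_def by (intro bdd_belowI2)
  have "convex_on UNIV Z"
  proof (rule convex_onI)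
    fix t :: real and \<xi> \<eta> :: "real ^ 'k"
    assume t: "0 < t" "t < 1"
    define \<theta> where "\<theta> = (1 - t) *\<^sub>R \<xi> + t *\<^sub>R \<eta>"
    have rhs: "h x + T x *v \<theta> = (1 - t) *\<^sub>R (h x + T x *v \<xi>) + t *\<^sub>R (h x + T x *v \<eta>)"
      by (simp add: \<theta>_def algebra_simps)
    have *: "Z \<theta> \<le> (1 - t) * (q \<bullet> y) + t * (q \<bullet> z)" if "y \<in> F \<xi>" "z \<in> F \<eta>" for y z
    proof -
      have "(1 - t) *\<^sub>R y + t *\<^sub>R z \<in> F \<theta>"
        unfolding F_def rhs
        by (rule second_stage_feasible_convex_comb[OF K]) (use that t in \<open>auto simp: F_def\<close>)
      from cINF_lower[OF bdd this] show ?thesis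
        by (simp add: Z_def inner_add_right)
    qed
    \<comment> \<open>The infima are taken one at a time: solve \<open>*\<close> for
      \<open>q \<bullet> y\<close> and minimize over \<open>y\<close> with \<open>z\<close> fixed,
      then do the same for \<open>z\<close>.\<close>
    have slope: "(Z \<theta> - t * (q \<bullet> z)) / (1 - t) \<le> Z \<xi>" if z: "z \<in> F \<eta>" for z
      unfolding Z_def[of \<xi>]
      by (rule cINF_greatest[OF ne]) (use *[OF _ z] t in \<open>simp add: divide_simps algebra_simps\<close>)
    have "(Z \<theta> - (1 - t) * Z \<xi>) / t \<le> q \<bullet> z" if "z \<in> F \<eta>" for z
      using slope[OF that] t by (simp add: divide_simps algebra_simps)
    then have "(Z \<theta> - (1 - t) * Z \<xi>) / t \<le> Z \<eta>"
      unfolding Z_def[of \<eta>] by (rule cINF_greatest[OF ne])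
    then show "Z ((1 - t) *\<^sub>R \<xi> + t *\<^sub>R \<eta>) \<le> (1 - t) * Z \<xi> + t * Z \<eta>"
      using t by (simp add: \<theta>_def divide_simps algebra_simps)
  qed simp
  moreover have "second_stage_cost K q W h T x \<xi> = ereal (Z \<xi>)" for \<xi>
  proof -
    have "bdd_below ((\<bullet>) q ` F \<xi>)" "(\<bullet>) q ` F \<xi> \<noteq> {}" using bdd ne by auto
    \<comment> \<open>On a nonempty set that is bounded below, the real and the extended infimum
      agree.\<close>
    then have "ereal (Inf ((\<bullet>) q ` F \<xi>)) = (INF a\<in>(\<bullet>) q ` F \<xi>. ereal a)"
      by (intro ereal_Inf') auto
    then show ?thesis
      by (simp add: second_stage_cost_def Z_def F_def image_image)
  qed
  ultimately show ?thesis by (rule that)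
qed

text \<open>The ray starts at the centre \<open>a\<close> of the penalty, so for
  \<open>t \<ge> 0\<close> the subtracted term is \<open>t\<close> times a constant, and subtracting
  a linear term keeps convexity.\<close>

lemma convex_on_penalized_ray:
  assumes Z: "convex_on UNIV Z" and p: "1 \<le> p"
  shows "convex_on {0..} (\<lambda>t. Z (a + t *\<^sub>R d) - lam * lp_norm p (a + t *\<^sub>R d - a))"
proof (rule convex_onI)
  fix t s r :: real
  assume t: "0 < t" "t < 1" and sr: "s \<in> {0..}" "r \<in> {0..}"
  define w where "w = (1 - t) *\<^sub>R s + t *\<^sub>R r"
  have w: "0 \<le> w" using t sr by (simp add: w_def)
  have "a + w *\<^sub>R d = (1 - t) *\<^sub>R (a + s *\<^sub>R d) + t *\<^sub>R (a + r *\<^sub>R d)"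
    by (simp add: w_def algebra_simps)
  then have "Z (a + w *\<^sub>R d) \<le> (1 - t) * Z (a + s *\<^sub>R d) + t * Z (a + r *\<^sub>R d)"
    using convex_onD[OF Z, of t "a + s *\<^sub>R d" "a + r *\<^sub>R d"] t by simp
  then have "Z (a + w *\<^sub>R d) - lam * lp_norm p (a + w *\<^sub>R d - a)
      \<le> (1 - t) * (Z (a + s *\<^sub>R d) - lam * lp_norm p (a + s *\<^sub>R d - a))
        + t * (Z (a + r *\<^sub>R d) - lam * lp_norm p (a + r *\<^sub>R d - a))"
    \<comment> \<open>\<open>w\<close> stays folded while homogeneity is applied; unfolding it
      afterwards makes the penalty terms cancel.\<close>
    using sr w by (simp add: lp_norm_scaleR[OF p]) (simp add: w_def algebra_simps)
  then show "Z (a + ((1 - t) *\<^sub>R s + t *\<^sub>R r) *\<^sub>R d)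
      - lam * lp_norm p (a + ((1 - t) *\<^sub>R s + t *\<^sub>R r) *\<^sub>R d - a)
      \<le> (1 - t) * (Z (a + s *\<^sub>R d) - lam * lp_norm p (a + s *\<^sub>R d - a))
        + t * (Z (a + r *\<^sub>R d) - lam * lp_norm p (a + r *\<^sub>R d - a))"
    by (simp only: w_def)
qed simp

text \<open>A finite supremum does not by itself provide a maximizer. The finite case therefore
  moves a maximizer into \<open>B\<close> if there is one, and equates the two suprema in any
  case.\<close>

theorem theorem3p2:
  fixes K :: "(real ^ 'ny) set" and q :: "real ^ 'ny" and W :: "real ^ 'ny ^ 'my"
    and h :: "real ^ 'nx \<Rightarrow> real ^ 'my" and T :: "real ^ 'nx \<Rightarrow> real ^ 'k ^ 'my"
    and p :: ereal and \<Xi> :: "(real ^ 'k) set" and x :: "real ^ 'nx"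
    and N :: nat and \<zeta> :: "nat \<Rightarrow> real ^ 'k" and lam :: real
  assumes "1 \<le> p"
    and "product_of_proper_cones K"
    and "affine_map h" and "affine_map T"
    and "complete_recourse K W"
    and "dual_strictly_feasible K q W"
    and "\<Xi> \<noteq> {}" and "closed \<Xi>" and "convex \<Xi>"
    and "\<forall>i\<in>{1..N}. \<zeta> i \<in> \<Xi>"
    and "0 \<le> lam"
  shows "\<forall>i\<in>{1..N}.
    let f = (\<lambda>j. penalized_cost K q W h T p lam x (\<zeta> j));
        v = (\<lambda>j. SUP \<xi>\<in>\<Xi>. f j \<xi>);
        B = frontier \<Xi> \<union> {\<zeta> i}
    in
      (\<bar>v i\<bar> \<noteq> \<infinity> \<longrightarrow>
         ((\<exists>\<xi>. is_arg_max (f i) (\<lambda>\<xi>. \<xi> \<in> \<Xi>) \<xi>) \<longrightarrow>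
            (\<exists>\<xi>\<in>B. is_arg_max (f i) (\<lambda>\<xi>. \<xi> \<in> \<Xi>) \<xi>)) \<and>
         (SUP \<xi>\<in>B. f i \<xi>) = v i) \<and>
      (\<not> \<bar>v i\<bar> \<noteq> \<infinity> \<longrightarrow>
         v i = \<infinity> \<and> \<not> (\<forall>j\<in>{1..N}. v j < \<infinity>))"
proof -
  have "dual_feasible K q W \<noteq> {}"
    using assms(6) by (auto simp: dual_strictly_feasible_def)
  then obtain Z where Z: "convex_on UNIV Z"
      and cost: "\<And>\<xi>. second_stage_cost K q W h T x \<xi> = ereal (Z \<xi>)"
    using second_stage_cost_convex product_of_proper_cones_convex assms(2,5) by metis
  define g where "g i \<xi> = Z \<xi> - lam * lp_norm p (\<xi> - \<zeta> i)" for i \<xi>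
  define f where "f i = penalized_cost K q W h T p lam x (\<zeta> i)" for i
  define v where "v i = (SUP \<xi>\<in>\<Xi>. f i \<xi>)" for i
  have f_eq: "f i \<xi> = ereal (g i \<xi>)" for i \<xi>
    by (simp add: f_def g_def penalized_cost_def cost)
  have "(\<bar>v i\<bar> \<noteq> \<infinity> \<longrightarrow>
         ((\<exists>\<xi>. is_arg_max (f i) (\<lambda>\<xi>. \<xi> \<in> \<Xi>) \<xi>) \<longrightarrow>
            (\<exists>\<xi>\<in>frontier \<Xi> \<union> {\<zeta> i}. is_arg_max (f i) (\<lambda>\<xi>. \<xi> \<in> \<Xi>) \<xi>)) \<and>
         (SUP \<xi>\<in>frontier \<Xi> \<union> {\<zeta> i}. f i \<xi>) = v i) \<and>
      (\<not> \<bar>v i\<bar> \<noteq> \<infinity> \<longrightarrow> v i = \<infinity> \<and> \<not> (\<forall>j\<in>{1..N}. v j < \<infinity>))"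
    if i: "i \<in> {1..N}" for i
  proof (intro conjI impI)
    have \<zeta>: "\<zeta> i \<in> \<Xi>" using assms(10) i by blast
    have B: "frontier \<Xi> \<union> {\<zeta> i} \<subseteq> \<Xi>"
      using \<zeta> frontier_subset_closed[OF assms(8)] by simp
    have upper: "f i \<xi> \<le> v i" if "\<xi> \<in> \<Xi>" for \<xi>
      using that by (simp add: v_def SUP_upper)
    {
      assume fin: "\<bar>v i\<bar> \<noteq> \<infinity>"
      then obtain M where M: "v i = ereal M" by auto
      have bdd: "g i \<xi> \<le> M" if "\<xi> \<in> \<Xi>" for \<xi>
        using upper[OF that] M by (simp add: f_eq)
      have dom: "\<exists>c \<in> frontier \<Xi> \<union> {\<zeta> i}. f i \<xi> \<le> f i c" if "\<xi> \<in> \<Xi>" for \<xi>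
        unfolding f_eq ereal_less_eq
        using assms(9) \<zeta> that
      proof (rule convex_on_ray_dominated)
        show "convex_on {0..} (\<lambda>t. g i (\<zeta> i + t *\<^sub>R (\<xi> - \<zeta> i)))"
          unfolding g_def by (rule convex_on_penalized_ray[OF Z assms(1)])
      qed (rule bdd)
      show "(SUP \<xi>\<in>frontier \<Xi> \<union> {\<zeta> i}. f i \<xi>) = v i"
        unfolding v_def using B dom
        by (intro antisym SUP_subset_mono SUP_mono) auto
      assume "\<exists>\<xi>. is_arg_max (f i) (\<lambda>\<xi>. \<xi> \<in> \<Xi>) \<xi>"
      then obtain \<xi> where \<xi>: "\<xi> \<in> \<Xi>" "\<And>\<eta>. \<eta> \<in> \<Xi> \<Longrightarrow> f i \<eta> \<le> f i \<xi>"
        by (auto simp: is_arg_max_linorder)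
      obtain c where "c \<in> frontier \<Xi> \<union> {\<zeta> i}" "f i \<xi> \<le> f i c"
        using dom[OF \<xi>(1)] by blast
      then show "\<exists>\<xi>\<in>frontier \<Xi> \<union> {\<zeta> i}. is_arg_max (f i) (\<lambda>\<xi>. \<xi> \<in> \<Xi>) \<xi>"
        using B \<xi>(2) unfolding is_arg_max_linorder by (meson order_trans subsetD)
    next
      assume "\<not> \<bar>v i\<bar> \<noteq> \<infinity>"
      \<comment> \<open>The real value at \<open>\<zeta> i\<close> excludes minus infinity, so a
        non-finite supremum is plus infinity, and \<open>i\<close> itself violates the condition on
        \<open>lam\<close>.\<close>
      moreover have "v i \<noteq> - \<infinity>"
        using upper[OF \<zeta>] by (auto simp: f_eq)
      ultimately show inf: "v i = \<infinity>" by auto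
      show "\<not> (\<forall>j\<in>{1..N}. v j < \<infinity>)"
        using inf i by force
    }
  qed
  then show ?thesis
    unfolding Let_def v_def f_def by (rule ballI)
qed

end
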